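(* Let $\Omega_0=\{(x_2,x_3)\in\mathbb{R}^2: x_3<0\}$. There exists a numerical constant $c_0$ (for example $c_0=5$ works) such that for every $u\in C^2(\overline{\Omega}_0)\cap L^\infty(\Omega_0)$ with $Lu=0$, where $L=\Delta+\mathbf{e}_3\cdot\nabla=\partial_2^2+\partial_3^2+\partial_3$, one has $$\left|u(x_2,x_3)-\frac{1}{\sqrt{-4\pi x_3}}\int_{-\infty}^\infty e^{\frac{(x_2'-x_2)^2}{4x_3}}\,u(x_2',0)\,dx_2'\right|\le\frac{c_0\|u\|_\infty}{\sqrt{-x_3}}$$ for all $x_2\in\mathbb{R}$ and all $x_3\le-1$.
   Context: Coordinates on $\mathbb{R}^2$ are $(x_2,x_3)$, $\mathbf{e}_3=(0,1)$. $\|u\|_\infty$ is the supremum norm on $\Omega_0$. *)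

theory Defs
  imports "HOL-Analysis.Analysis"
begin

definition partial_deriv :: "'a::euclidean_space \<Rightarrow> ('a \<Rightarrow> real) \<Rightarrow> 'a \<Rightarrow> real" where
  "partial_deriv b f p = deriv (\<lambda>t. f (p + t *\<^sub>R b)) 0"

definition has_partial_deriv_at :: "'a::euclidean_space \<Rightarrow> ('a \<Rightarrow> real) \<Rightarrow> 'a \<Rightarrow> bool" where
  "has_partial_deriv_at b f p \<longleftrightarrow> (\<lambda>t. f (p + t *\<^sub>R b)) differentiable (at 0)"

definition extends_to_closure :: "'a::euclidean_space set \<Rightarrow> ('a \<Rightarrow> real) \<Rightarrow> bool" where
  "extends_to_closure S f \<longleftrightarrow>
     (\<exists>g. continuous_on (closure S) g \<and> (\<forall>p\<in>S. g p = f p))"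

text \<open>For open \<open>S\<close>: all partial derivatives of \<open>f\<close> of order at most \<open>k\<close> exist in \<open>S\<close>
  and extend continuously to the closure. Values of \<open>f\<close> outside \<open>S\<close> play no role here.\<close>

primrec derivs_extend :: "nat \<Rightarrow> 'a::euclidean_space set \<Rightarrow> ('a \<Rightarrow> real) \<Rightarrow> bool" where
  "derivs_extend 0 S f \<longleftrightarrow> extends_to_closure S f"
| "derivs_extend (Suc k) S f \<longleftrightarrow> extends_to_closure S f \<and>
     (\<forall>b\<in>Basis. (\<forall>p\<in>S. has_partial_deriv_at b f p) \<and> derivs_extend k S (partial_deriv b f))"

text \<open>The class \<open>C\<^sup>k\<close> on the closure of an open set \<open>S\<close>. Continuity of \<open>f\<close> itself on the closure
  makes its boundary values the limits of its values in \<open>S\<close>. No bound on the derivatives is imposed.\<close>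

definition Ck_closure :: "nat \<Rightarrow> 'a::euclidean_space set \<Rightarrow> ('a \<Rightarrow> real) \<Rightarrow> bool" where
  "Ck_closure k S f \<longleftrightarrow> continuous_on (closure S) f \<and> derivs_extend k S f"

definition sup_norm :: "'a set \<Rightarrow> ('a \<Rightarrow> real) \<Rightarrow> real" where
  "sup_norm S f = (SUP p\<in>S. \<bar>f p\<bar>)"

text \<open>A point of the plane is the pair \<open>(x2, x3)\<close>.\<close>

definition Omega0 :: "(real \<times> real) set" where
  "Omega0 = {(x2, x3). x3 < 0}"

definition e2 :: "real \<times> real" where "e2 = (1, 0)"

definition e3 :: "real \<times> real" where "e3 = (0, 1)"

definition drift_laplacian :: "(real \<times> real \<Rightarrow> real) \<Rightarrow> real \<times> real \<Rightarrow> real" where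
  "drift_laplacian u p =
     partial_deriv e2 (partial_deriv e2 u) p + partial_deriv e3 (partial_deriv e3 u) p
       + partial_deriv e3 u p"

end

theory Submission
  imports Defs "HOL-Probability.Probability" "HOL-Real_Asymp.Real_Asymp"
begin

text \<open>Write \<open>t = - x3\<close>. The equation says that \<open>u (x, - t)\<close> is the expectation of the boundary data at the
  point where a diffusion, with unit drift towards the boundary, leaves the half plane. Conditioning on
  the exit time \<open>T\<close> gives \<open>u (\<cdot>, - t) = E (S\<^sub>T f)\<close>, where \<open>S\<close> is the heat semigroup, \<open>f = u (\<cdot>, 0)\<close>,
  and \<open>T\<close> has the inverse Gaussian law with mean \<open>t\<close> and variance \<open>2 t\<close>. Since
  \<open>\<parallel>S\<^sub>s f - S\<^sub>t f\<parallel> \<le> \<parallel>f\<parallel> \<bar>s - t\<bar> / sqrt (s t)\<close>, the error is at most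
  \<open>\<parallel>f\<parallel> E (\<bar>T - t\<bar> / sqrt (T t)) \<le> 4 \<parallel>f\<parallel> / sqrt (\<pi> t)\<close>.

  Nothing has to be differentiated under an integral: for a trigonometric polynomial \<open>f\<close> the solution is
  explicit and the subordination formula is the Laplace transform of the law of \<open>T\<close>. General
  data are approximated by trigonometric polynomials uniformly on a large interval and boundedly
  elsewhere; a maximum principle with the barrier \<open>x2\<^sup>2 - 3 x3\<close> controls the resulting error.\<close>

section \<open>The heat semigroup\<close>

text \<open>The standard deviation is \<open>sqrt (2 * s)\<close> because the generator is the plain
  second derivative, without the factor 1/2 of Brownian motion.\<close>

definition heat :: "real \<Rightarrow> (real \<Rightarrow> real) \<Rightarrow> real \<Rightarrow> real" where
  "heat s p x = (LINT y|lborel. normal_density x (sqrt (2 * s)) y * p y)"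

lemma integrable_normal_density_mult:
  assumes "0 < \<sigma>" "p \<in> borel_measurable borel" "\<And>y. \<bar>p y\<bar> \<le> M"
  shows "integrable lborel (\<lambda>y. normal_density \<mu> \<sigma> y * p y)"
proof (rule Bochner_Integration.integrable_bound)
  show "integrable lborel (\<lambda>y. normal_density \<mu> \<sigma> y * M)"
    using assms(1) by simp
  show "AE y in lborel. norm (normal_density \<mu> \<sigma> y * p y) \<le> norm (normal_density \<mu> \<sigma> y * M)"
    using assms(3) by (auto simp: abs_mult intro!: mult_left_mono order_trans[OF _ abs_ge_self])
qed (use assms(2) in measurable)

lemma integrable_heat:
  assumes "0 < s" "p \<in> borel_measurable borel" "\<And>y. \<bar>p y\<bar> \<le> M"
  shows "integrable lborel (\<lambda>y. normal_density x (sqrt (2 * s)) y * p y)"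
  using integrable_normal_density_mult[of "sqrt (2 * s)" p M x] assms by simp

text \<open>The two integrals are the real and imaginary parts of the characteristic function of the
  standard normal law, which is real.\<close>

lemma std_normal_integral_cos_sin:
  shows "integrable lborel (\<lambda>z. std_normal_density z * cos (k * z))"
    and "integrable lborel (\<lambda>z. std_normal_density z * sin (k * z))"
    and "(LINT z|lborel. std_normal_density z * cos (k * z)) = exp (- k\<^sup>2 / 2)"
    and "(LINT z|lborel. std_normal_density z * sin (k * z)) = 0"
proof -
  show c: "integrable lborel (\<lambda>z. std_normal_density z * cos (k * z))"
    by (rule integrable_normal_density_mult[where M=1]) auto
  show s: "integrable lborel (\<lambda>z. std_normal_density z * sin (k * z))"
    by (rule integrable_normal_density_mult[where M=1]) auto
  have "complex_of_real (exp (- k\<^sup>2 / 2)) = char std_normal_distribution k"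
    by (simp add: char_std_normal_distribution)
  also have "\<dots> = (CLINT z|lborel. std_normal_density z *\<^sub>R iexp (k * z))"
    unfolding char_def by (subst integral_density) auto
  also have "(\<lambda>z. std_normal_density z *\<^sub>R iexp (k * z)) =
      (\<lambda>z. complex_of_real (std_normal_density z * cos (k * z)) +
        \<i> * complex_of_real (std_normal_density z * sin (k * z)))"
    by (auto simp: fun_eq_iff complex_eq_iff Re_exp Im_exp)
  also have "(CLINT z|lborel. complex_of_real (std_normal_density z * cos (k * z)) +
        \<i> * complex_of_real (std_normal_density z * sin (k * z))) =
      complex_of_real (LINT z|lborel. std_normal_density z * cos (k * z)) +
      \<i> * complex_of_real (LINT z|lborel. std_normal_density z * sin (k * z))"
    using c s by (subst Bochner_Integration.integral_add)
      (simp_all only: integral_complex_of_real integral_mult_right_zero integrable_mult_right complex_of_real_integrable_eq)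
  finally have e: "complex_of_real (exp (- k\<^sup>2 / 2)) = complex_of_real (LINT z|lborel. std_normal_density z * cos (k * z)) +
      \<i> * complex_of_real (LINT z|lborel. std_normal_density z * sin (k * z))" .
  show "(LINT z|lborel. std_normal_density z * cos (k * z)) = exp (- k\<^sup>2 / 2)"
    using arg_cong[OF e, of Re] by simp
  show "(LINT z|lborel. std_normal_density z * sin (k * z)) = 0"
    using arg_cong[OF e, of Im] by simp
qed

text \<open>Cosines with a phase are eigenfunctions of the semigroup. The substitution
  \<open>y = x + c * z\<close> passes to the standard normal density; in the addition formula the
  sine part integrates to zero and the cosine part gives the factor.\<close>

lemma heat_cos:
  assumes "0 < s"
  shows "heat s (\<lambda>y. cos (k * y + \<theta>)) x = exp (- k\<^sup>2 * s) * cos (k * x + \<theta>)"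
proof -
  define c where "c = sqrt (2 * s)"
  have c: "c > 0" "c\<^sup>2 = 2 * s" using assms by (auto simp: c_def)
  have "heat s (\<lambda>y. cos (k * y + \<theta>)) x =
     \<bar>c\<bar> *\<^sub>R (LINT z|lborel. normal_density x c (x + c * z) * cos (k * (x + c * z) + \<theta>))"
    unfolding heat_def c_def[symmetric]
    by (rule lborel_integral_real_affine) (use c in auto)
  also have "\<dots> = (LINT z|lborel. c * (normal_density x c (x + c * z) * cos (k * (x + c * z) + \<theta>)))"
    using c by simp
  also have "\<dots> = (LINT z|lborel. cos (k * x + \<theta>) * (std_normal_density z * cos (k * c * z))
       - sin (k * x + \<theta>) * (std_normal_density z * sin (k * c * z)))"
  proof (rule Bochner_Integration.integral_cong[OF refl])
    fix z
    have "c * normal_density x c (x + c * z) = std_normal_density z"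
      using c(1) by (simp add: normal_density_def power_mult_distrib real_sqrt_mult)
    moreover have "cos (k * (x + c * z) + \<theta>) =
        cos (k * x + \<theta>) * cos (k * c * z) - sin (k * x + \<theta>) * sin (k * c * z)"
      by (subst cos_add[symmetric]) (simp add: algebra_simps)
    ultimately show "c * (normal_density x c (x + c * z) * cos (k * (x + c * z) + \<theta>)) =
      cos (k * x + \<theta>) * (std_normal_density z * cos (k * c * z))
       - sin (k * x + \<theta>) * (std_normal_density z * sin (k * c * z))"
      by (simp only: mult.assoc[symmetric] right_diff_distrib) (simp only: ac_simps)
  qed
  also have "\<dots> = cos (k * x + \<theta>) * exp (- (k * c)\<^sup>2 / 2)"
    by (subst Bochner_Integration.integral_diff)
      (simp_all add: std_normal_integral_cos_sin)
  finally show ?thesis using c by (simp add: power_mult_distrib mult.commute)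
qed

text \<open>The factor \<open>sqrt (s / t)\<close> equalises the prefactors of the two kernels, and
  what remains compares Gaussian exponentials, which increase with time.\<close>

lemma heat_density_ratio:
  assumes "0 < s" "s \<le> t"
  shows "sqrt (s / t) * normal_density x (sqrt (2 * s)) y \<le> normal_density x (sqrt (2 * t)) y"
proof -
  have t: "0 < t" using assms by linarith
  have "sqrt (s / t) * normal_density x (sqrt (2 * s)) y =
      1 / sqrt (4 * pi * t) * exp (- (y - x)\<^sup>2 / (4 * s))"
    using assms t by (simp add: normal_density_def real_sqrt_mult real_sqrt_divide field_simps)
  also have "\<dots> \<le> 1 / sqrt (4 * pi * t) * exp (- (y - x)\<^sup>2 / (4 * t))"
    using assms t by (intro mult_left_mono) (auto simp: divide_left_mono)
  also have "\<dots> = normal_density x (sqrt (2 * t)) y"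
    using assms t by (simp add: normal_density_def)
  finally show ?thesis .
qed

text \<open>Subtracting \<open>sqrt (s / t) * G\<^sub>s\<close> from the kernel \<open>G\<^sub>t\<close> leaves a nonnegative
  function of mass \<open>1 - sqrt (s / t)\<close>.\<close>

lemma abs_heat_diff_le_sqrt:
  assumes "0 < s" "s \<le> t" and p: "p \<in> borel_measurable borel" "\<And>y. \<bar>p y\<bar> \<le> M"
  shows "\<bar>heat t p x - heat s p x\<bar> \<le> 2 * (1 - sqrt (s / t)) * M"
proof -
  define q where "q = sqrt (s / t)"
  define Gs where "Gs = normal_density x (sqrt (2 * s))"
  define Gt where "Gt = normal_density x (sqrt (2 * t))"
  have t: "0 < t" using assms by linarith
  have q: "q \<le> 1" using assms t by (simp add: q_def)
  have int: "integrable lborel Gs" "integrable lborel Gt" "integral\<^sup>L lborel Gs = 1" "integral\<^sup>L lborel Gt = 1"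
    using assms t by (simp_all add: Gs_def Gt_def)
  have ints: "integrable lborel (\<lambda>y. Gs y * p y)" "integrable lborel (\<lambda>y. Gt y * p y)"
    unfolding Gs_def Gt_def using integrable_heat[OF _ p] assms t by auto
  have heq: "heat s p x = (LINT y|lborel. Gs y * p y)" "heat t p x = (LINT y|lborel. Gt y * p y)"
    by (simp_all add: heat_def Gs_def Gt_def)
  have "\<bar>heat t p x - q * heat s p x\<bar> = \<bar>LINT y|lborel. (Gt y - q * Gs y) * p y\<bar>"
    using ints by (simp add: heq left_diff_distrib mult.assoc)
  also have "\<dots> \<le> (LINT y|lborel. (Gt y - q * Gs y) * M)"
  proof (rule integral_abs_bound_integral)
    show "integrable lborel (\<lambda>y. (Gt y - q * Gs y) * p y)"
      using ints by (simp add: left_diff_distrib mult.assoc)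
    show "integrable lborel (\<lambda>y. (Gt y - q * Gs y) * M)"
      using int by simp
    fix y
    have "0 \<le> Gt y - q * Gs y"
      using heat_density_ratio[OF assms(1,2)] by (simp add: Gt_def Gs_def q_def)
    then show "\<bar>(Gt y - q * Gs y) * p y\<bar> \<le> (Gt y - q * Gs y) * M"
      using p(2)[of y] by (simp add: abs_mult mult_left_mono)
  qed
  also have "\<dots> = (1 - q) * M" using int by simp
  finally have 1: "\<bar>heat t p x - q * heat s p x\<bar> \<le> (1 - q) * M" .
  have "\<bar>heat s p x\<bar> \<le> (LINT y|lborel. Gs y * M)"
    unfolding heq
  proof (rule integral_abs_bound_integral)
    show "\<bar>Gs y * p y\<bar> \<le> Gs y * M" for y
      using p(2)[of y] by (simp add: abs_mult mult_left_mono Gs_def)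
  qed (use ints int in auto)
  then have "\<bar>heat s p x\<bar> \<le> M" using int by simp
  then have "\<bar>(1 - q) * heat s p x\<bar> \<le> (1 - q) * M" using q by (simp add: abs_mult mult_left_mono)
  with 1 have "\<bar>heat t p x - heat s p x\<bar> \<le> 2 * ((1 - q) * M)"
    by (simp add: algebra_simps)
  then show ?thesis by (simp only: q_def mult.assoc)
qed

text \<open>With \<open>a = sqrt s\<close> and \<open>b = sqrt t\<close> the right side minus the
  left side is \<open>(b - a)^2 / (a * b)\<close>.\<close>

lemma one_minus_sqrt_ratio_le:
  fixes s t :: real
  assumes "0 < s" "s \<le> t"
  shows "2 * (1 - sqrt (s / t)) \<le> (t - s) / sqrt (s * t)"
proof -
  define a b where "a = sqrt s" and "b = sqrt t"
  have ab: "0 < a" "a \<le> b" "s = a\<^sup>2" "t = b\<^sup>2" using assms by (auto simp: a_def b_def)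
  have "0 \<le> (b - a)\<^sup>2 * b" using ab by simp
  moreover have "0 \<le> (b - a) * (b - a) * a" using ab by simp
  ultimately have "2 * (1 - a / b) \<le> (b\<^sup>2 - a\<^sup>2) / (a * b)"
    using ab by (simp add: field_simps power2_eq_square)
  moreover have "sqrt (s / t) = a / b" "sqrt (s * t) = a * b" using ab
    by (simp_all add: real_sqrt_divide real_sqrt_mult)
  ultimately show ?thesis using ab by simp
qed

lemma abs_heat_diff_le:
  assumes "0 < s" "0 < t" and p: "p \<in> borel_measurable borel" "\<And>y. \<bar>p y\<bar> \<le> M"
  shows "\<bar>heat s p x - heat t p x\<bar> \<le> M * (\<bar>s - t\<bar> / sqrt (s * t))"
proof -
  have M: "0 \<le> M" using p(2)[of 0] by linarith
  show ?thesis
  proof (cases "s \<le> t")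
    case True
    then have "\<bar>heat s p x - heat t p x\<bar> \<le> 2 * (1 - sqrt (s / t)) * M"
      using abs_heat_diff_le_sqrt[OF assms(1) True p, of x] by (subst abs_minus_commute)
    also have "\<dots> \<le> (t - s) / sqrt (s * t) * M"
      using one_minus_sqrt_ratio_le[OF assms(1) True] M by (intro mult_right_mono)
    finally show ?thesis using True by (simp add: mult.commute)
  next
    case False
    then have "\<bar>heat s p x - heat t p x\<bar> \<le> 2 * (1 - sqrt (t / s)) * M"
      using abs_heat_diff_le_sqrt[OF assms(2) _ p, of s] by simp
    also have "\<dots> \<le> (s - t) / sqrt (t * s) * M"
      using one_minus_sqrt_ratio_le[OF assms(2), of s] False M by (intro mult_right_mono) auto
    finally show ?thesis using False by (simp add: mult.commute)
  qed
qed

section \<open>The law of the exit time\<close>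

text \<open>Bundles integrability with the value of the integral, for an antiderivative known at
  possibly infinite endpoints only through its one-sided limits.\<close>

lemma has_bochner_integral_FTC_nonneg:
  fixes f F :: "real \<Rightarrow> real" and a b :: ereal
  assumes "a < b"
  assumes F: "\<And>x. x \<in> einterval a b \<Longrightarrow> (F has_real_derivative f x) (at x)"
  assumes f: "\<And>x. x \<in> einterval a b \<Longrightarrow> isCont f x"
  assumes nonneg: "\<And>x. x \<in> einterval a b \<Longrightarrow> 0 \<le> f x"
  assumes A: "((F \<circ> real_of_ereal) \<longlongrightarrow> A) (at_right a)"
  assumes B: "((F \<circ> real_of_ereal) \<longlongrightarrow> B) (at_left b)"
  shows "has_bochner_integral lborel (\<lambda>x. indicator (einterval a b) x * f x) (B - A)"
proof -
  have "set_integrable lborel (einterval a b) f" "(LBINT x=a..b. f x) = B - A"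
    using assms by (auto intro!: interval_integral_FTC_nonneg[where F=F] simp: einterval_iff)
  then show ?thesis using \<open>a < b\<close>
    by (simp add: has_bochner_integral_iff set_integrable_def
        interval_lebesgue_integral_def set_lebesgue_integral_def less_imp_le)
qed

definition normal_cdf :: "real \<Rightarrow> real" where
  "normal_cdf = cdf std_normal_distribution"

lemma normal_cdf_deriv: "(normal_cdf has_real_derivative std_normal_density x) (at x)"
proof -
  have cont: "continuous_on S std_normal_density" for S
    unfolding normal_density_def by (intro continuous_intros) auto
  \<comment> \<open>The base point \<open>x - 1\<close> puts \<open>x\<close> in the interior of the
    interval of integration, so the fundamental theorem yields a two-sided derivative at
    \<open>x\<close>.\<close>
  have eq: "normal_cdf y = normal_cdf (x - 1) + integral {x - 1..y} std_normal_density" if "x - 1 < y" for y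
  proof -
    interpret prob_space std_normal_distribution by (rule prob_space_normal_density) simp
    have "normal_cdf y - normal_cdf (x - 1) = measure std_normal_distribution {x - 1<..y}"
      unfolding normal_cdf_def by (rule finite_borel_measure.cdf_diff_eq[OF _ that])
        (simp add: real_distribution.finite_borel_measure_M real_dist_normal_dist)
    also have "\<dots> = (LINT z|std_normal_distribution. indicator {x - 1<..y} z)"
      by simp
    also have "\<dots> = (LINT z|lborel. std_normal_density z *\<^sub>R indicator {x - 1<..y} z)"
      by (subst integral_density) auto
    also have "\<dots> = (LINT z:{x - 1<..y}|lborel. std_normal_density z)"
      unfolding set_lebesgue_integral_def by (simp add: mult.commute)
    also have "\<dots> = (LINT z:{x - 1..y}|lborel. std_normal_density z)"
      by (rule set_integral_cong_set)
        (auto simp: set_borel_measurable_def intro!: AE_I'[of "{x - 1}"])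
    also have "\<dots> = integral {x - 1..y} std_normal_density"
      by (rule set_borel_integral_eq_integral(2)) 
        (use integrable_mult_indicator[of "{x - 1..y}" lborel std_normal_density]
          in \<open>simp add: set_integrable_def\<close>)
    finally show ?thesis by simp
  qed
  have "((\<lambda>y. integral {x - 1..y} std_normal_density) has_real_derivative std_normal_density x)
     (at x within {x - 1..x + 1})"
    by (rule integral_has_real_derivative[OF cont]) auto
  then have "((\<lambda>y. integral {x - 1..y} std_normal_density) has_real_derivative std_normal_density x) (at x)"
    by (simp add: at_within_Icc_at)
  then have "((\<lambda>y. normal_cdf (x - 1) + integral {x - 1..y} std_normal_density)
      has_real_derivative std_normal_density x) (at x)"
    by (auto intro!: derivative_eq_intros)
  then show ?thesis
  proof (rule has_field_derivative_transform_within_open)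
    show "open {x - 1<..}" by simp
  qed (auto simp: eq)
qed

lemma normal_cdf_lim:
  "(normal_cdf \<longlongrightarrow> 1) at_top" "(normal_cdf \<longlongrightarrow> 0) at_bot"
proof -
  interpret real_distribution std_normal_distribution by (rule real_dist_normal_dist)
  show "(normal_cdf \<longlongrightarrow> 1) at_top" "(normal_cdf \<longlongrightarrow> 0) at_bot"
    unfolding normal_cdf_def by (rule cdf_lim_at_top_prob cdf_lim_at_bot)+
qed

text \<open>The antiderivative is the distribution function of the inverse Gaussian law.\<close>

lemma tilted_hitting_density_integral:
  fixes \<mu> t :: real
  assumes "0 < \<mu>" "0 < t"
  shows "has_bochner_integral lborel
    (\<lambda>s. indicator {0<..} s * (t / (2 * sqrt pi * (s * sqrt s)) * exp (- (\<mu> * s - t)\<^sup>2 / (4 * s)))) 1"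
proof -
  define a where "a = (\<lambda>s. (\<mu> * s - t) / sqrt (2 * s))"
  define b where "b = (\<lambda>s. - (\<mu> * s + t) / sqrt (2 * s))"
  define F where "F = (\<lambda>s. normal_cdf (a s) + exp (\<mu> * t) * normal_cdf (b s))"
  define f where "f = (\<lambda>s. t / (2 * sqrt pi * (s * sqrt s)) * exp (- (\<mu> * s - t)\<^sup>2 / (4 * s)))"
  have "has_bochner_integral lborel (\<lambda>s. indicator (einterval (ereal 0) \<infinity>) s * f s) (1 - 0)"
  proof (rule has_bochner_integral_FTC_nonneg)
    fix s :: real assume "s \<in> einterval (ereal 0) \<infinity>"
    then have s: "0 < s" by simp
    define r where "r = sqrt s"
    have r: "0 < r" "s = r\<^sup>2" using s by (auto simp: r_def)
    have da: "(a has_real_derivative (\<mu> * s + t) / (2 * sqrt 2 * (s * sqrt s))) (at s)"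
      unfolding a_def using s r
      by (auto intro!: derivative_eq_intros simp: real_sqrt_mult r_def[symmetric])
        (simp add: field_simps power2_eq_square)
    have db: "(b has_real_derivative - ((\<mu> * s - t) / (2 * sqrt 2 * (s * sqrt s)))) (at s)"
      unfolding b_def using s r
      by (auto intro!: derivative_eq_intros simp: real_sqrt_mult r_def[symmetric])
        (simp add: field_simps power2_eq_square)
    have pa: "std_normal_density (a s) = 1 / sqrt (2 * pi) * exp (- (\<mu> * s - t)\<^sup>2 / (4 * s))"
      using s by (simp add: std_normal_density_def a_def power_divide)
    \<comment> \<open>Since
      \<open>(\<mu> * s + t)^2 - (\<mu> * s - t)^2 = 4 * \<mu> * s * t\<close>, the weight
      \<open>exp (\<mu> * t)\<close> in \<open>F\<close> gives both normal densities the same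
      Gaussian factor. The derivatives of \<open>a\<close> and \<open>b\<close> then combine and
      only the multiple of \<open>t\<close> survives.\<close>
    have "\<mu> * t + - (\<mu> * s + t)\<^sup>2 / (4 * s) = - (\<mu> * s - t)\<^sup>2 / (4 * s)"
      using s by (simp add: field_simps power2_eq_square)
    then have pb: "exp (\<mu> * t) * std_normal_density (b s) = 1 / sqrt (2 * pi) * exp (- (\<mu> * s - t)\<^sup>2 / (4 * s))"
      using s by (simp add: std_normal_density_def b_def power_divide exp_add[symmetric]
          del: minus_add_distrib)
    have alg: "p * X + c * (q * (- Y)) = w * (X - Y)" if "p = w" "c * q = w" for p c q w X Y :: real
      using that(1) by (simp add: algebra_simps flip: that(2))
    have "(F has_real_derivative
        std_normal_density (a s) * ((\<mu> * s + t) / (2 * sqrt 2 * (s * sqrt s))) +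
        exp (\<mu> * t) * (std_normal_density (b s) * (- ((\<mu> * s - t) / (2 * sqrt 2 * (s * sqrt s)))))) (at s)"
      unfolding F_def
      by (intro DERIV_add DERIV_cmult DERIV_chain2[OF normal_cdf_deriv] da db)
    also have "std_normal_density (a s) * ((\<mu> * s + t) / (2 * sqrt 2 * (s * sqrt s))) +
        exp (\<mu> * t) * (std_normal_density (b s) * (- ((\<mu> * s - t) / (2 * sqrt 2 * (s * sqrt s))))) =
        1 / sqrt (2 * pi) * exp (- (\<mu> * s - t)\<^sup>2 / (4 * s)) *
        ((\<mu> * s + t) / (2 * sqrt 2 * (s * sqrt s)) - ((\<mu> * s - t) / (2 * sqrt 2 * (s * sqrt s))))"
      by (rule alg[OF pa pb])
    also have "(\<mu> * s + t) / (2 * sqrt 2 * (s * sqrt s)) - ((\<mu> * s - t) / (2 * sqrt 2 * (s * sqrt s))) =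
       2 * t / (2 * sqrt 2 * (s * sqrt s))"
      by (simp add: diff_divide_distrib[symmetric])
    also have "1 / sqrt (2 * pi) * exp (- (\<mu> * s - t)\<^sup>2 / (4 * s)) * (2 * t / (2 * sqrt 2 * (s * sqrt s))) = f s"
      using s by (simp add: f_def real_sqrt_mult field_simps)
    finally show "(F has_real_derivative f s) (at s)" .
    show "isCont f s" unfolding f_def using s by (intro continuous_intros) auto
    show "0 \<le> f s" unfolding f_def using s assms by simp
  next
    have "filterlim a at_bot (at_right 0)" "filterlim b at_bot (at_right 0)"
      unfolding a_def b_def using assms by real_asymp+
    then have "((\<lambda>s. normal_cdf (a s)) \<longlongrightarrow> 0) (at_right 0)" "((\<lambda>s. normal_cdf (b s)) \<longlongrightarrow> 0) (at_right 0)"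
      by (auto intro: filterlim_compose[OF normal_cdf_lim(2)])
    then have "(F \<longlongrightarrow> 0 + exp (\<mu> * t) * 0) (at_right 0)"
      unfolding F_def by (intro tendsto_intros)
    then show "((F \<circ> real_of_ereal) \<longlongrightarrow> 0) (at_right (ereal 0))"
      by (simp only: ereal_tendsto_simps) simp
    \<comment> \<open>At 0 both arguments tend to minus infinity, so \<open>F\<close> starts from 0;
      here only \<open>a\<close> changes sign, so the total mass is 1.\<close>
    have "filterlim a at_top at_top" "filterlim b at_bot at_top"
      unfolding a_def b_def using assms by real_asymp+
    then have "((\<lambda>s. normal_cdf (a s)) \<longlongrightarrow> 1) at_top" "((\<lambda>s. normal_cdf (b s)) \<longlongrightarrow> 0) at_top"
      by (auto intro: filterlim_compose[OF normal_cdf_lim(1)] filterlim_compose[OF normal_cdf_lim(2)])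
    then have "(F \<longlongrightarrow> 1 + exp (\<mu> * t) * 0) at_top"
      unfolding F_def by (intro tendsto_intros)
    then show "((F \<circ> real_of_ereal) \<longlongrightarrow> 1) (at_left \<infinity>)"
      by (simp only: ereal_tendsto_simps) simp
  qed simp
  then show ?thesis by (simp add: f_def)
qed

text \<open>The inverse Gaussian density with mean \<open>t\<close> and variance
  \<open>2 * t\<close>, the law of the exit time \<open>T\<close>. The indicator removes nonpositive
  times, so integrals can run over the whole line.\<close>

definition hitting_density :: "real \<Rightarrow> real \<Rightarrow> real" where
  "hitting_density t s =
     indicator {0<..} s * (t / (2 * sqrt pi * (s * sqrt s)) * exp (- (s - t)\<^sup>2 / (4 * s)))"

lemma hitting_density_nonneg: "0 < t \<Longrightarrow> 0 \<le> hitting_density t s"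
  by (simp add: hitting_density_def indicator_def)

lemma hitting_density_eq_0: "s \<le> 0 \<Longrightarrow> hitting_density t s = 0"
  by (simp add: hitting_density_def)

lemma measurable_hitting_density [measurable]: "hitting_density t \<in> borel_measurable borel"
  unfolding hitting_density_def[abs_def] by measurable

text \<open>\<open>exp (- decay_rate (k\<^sup>2) * t) * cos (k * x)\<close> is the bounded solution with data \<open>cos (k * x)\<close>.\<close>

definition decay_rate :: "real \<Rightarrow> real" where
  "decay_rate \<kappa> = (sqrt (1 + 4 * \<kappa>) - 1) / 2"

lemma decay_rate_eq: "0 \<le> \<kappa> \<Longrightarrow> (decay_rate \<kappa>)\<^sup>2 + decay_rate \<kappa> = \<kappa>"
  by (simp add: decay_rate_def power2_eq_square field_simps)

lemma decay_rate_nonneg: "0 \<le> \<kappa> \<Longrightarrow> 0 \<le> decay_rate \<kappa>"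
  by (simp add: decay_rate_def)

text \<open>Multiplying by \<open>exp (- \<kappa> * s)\<close> only changes the drift, from \<open>1\<close> to \<open>sqrt (1 + 4 * \<kappa>)\<close>.\<close>

lemma hitting_density_laplace:
  assumes "0 < t" "0 \<le> \<kappa>"
  shows "has_bochner_integral lborel (\<lambda>s. hitting_density t s * exp (- \<kappa> * s)) (exp (- decay_rate \<kappa> * t))"
proof -
  define \<mu> where "\<mu> = sqrt (1 + 4 * \<kappa>)"
  have \<mu>: "0 < \<mu>" "\<mu>\<^sup>2 = 1 + 4 * \<kappa>" "decay_rate \<kappa> = (\<mu> - 1) / 2"
    using assms by (auto simp: \<mu>_def decay_rate_def)
  have "hitting_density t s * exp (- \<kappa> * s) = exp (- decay_rate \<kappa> * t) *
     (indicator {0<..} s * (t / (2 * sqrt pi * (s * sqrt s)) * exp (- (\<mu> * s - t)\<^sup>2 / (4 * s))))" for s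
  proof (cases "0 < s")
    case True
    \<comment> \<open>Completing the square: by \<open>\<mu>^2 = 1 + 4 * \<kappa>\<close> the terms
      in \<open>s^2\<close> agree, and the cross terms differ exactly by the decay exponent.\<close>
    have "- (s - t)\<^sup>2 / (4 * s) + - \<kappa> * s = - decay_rate \<kappa> * t + - (\<mu> * s - t)\<^sup>2 / (4 * s)"
    proof -
      have "- (s - t)\<^sup>2 + 4 * s * (- \<kappa> * s) = 4 * s * (- decay_rate \<kappa> * t) - (\<mu> * s - t)\<^sup>2"
      proof -
        have "4 * s * (- decay_rate \<kappa> * t) = - 2 * s * t * (\<mu> - 1)" by (simp add: \<mu>(3))
        then show ?thesis
          unfolding power2_diff power_mult_distrib \<mu>(2) by (simp add: algebra_simps power2_eq_square)
      qed
      then show ?thesis using True by (simp add: field_simps)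
    qed
    then have "exp (- (s - t)\<^sup>2 / (4 * s)) * exp (- \<kappa> * s) =
       exp (- decay_rate \<kappa> * t) * exp (- (\<mu> * s - t)\<^sup>2 / (4 * s))"
      by (simp only: exp_add[symmetric])
    then show ?thesis by (simp add: hitting_density_def mult.assoc mult.left_commute)
  qed (simp add: hitting_density_def)
  then show ?thesis
    using has_bochner_integral_mult_right[where c = "exp (- decay_rate \<kappa> * t)",
        OF tilted_hitting_density_integral[OF \<mu>(1) assms(1)]]
    by simp
qed

text \<open>The derivative of \<open>exp (- (s - t)\<^sup>2 / (4 * s))\<close> is \<open>(t - s) * (s + t) / (4 * s\<^sup>2)\<close> times itself; as
  \<open>s + t \<ge> t\<close>, the integrand is bounded by a multiple of its modulus, and that function rises from
  0 to 1 and falls back to 0.\<close>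

lemma hitting_density_abs_deviation:
  assumes "0 < t"
  shows "integrable lborel (\<lambda>s. hitting_density t s * (\<bar>s - t\<bar> / sqrt (s * t)))"
    and "(LINT s|lborel. hitting_density t s * (\<bar>s - t\<bar> / sqrt (s * t))) \<le> 4 / (sqrt pi * sqrt t)"
proof -
  define E where "E = (\<lambda>s. exp (- (s - t)\<^sup>2 / (4 * s)))"
  define f where "f = (\<lambda>s. (s - t) * (s + t) / (4 * s\<^sup>2) * E s)"
  have dE: "(E has_real_derivative - f s) (at s)" "isCont f s" if "0 < s" for s
  proof -
    show "isCont f s" unfolding f_def E_def using that by (intro continuous_intros) auto
    show "(E has_real_derivative - f s) (at s)"
      unfolding E_def f_def using that
      by (auto intro!: derivative_eq_intros) (simp add: field_simps power2_eq_square)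
  qed
  have Et: "isCont E t" using DERIV_isCont[OF dE(1)] assms by simp
  have "has_bochner_integral lborel (\<lambda>s. indicator (einterval (ereal 0) (ereal t)) s * - f s) (E t - 0)"
  proof (rule has_bochner_integral_FTC_nonneg)
    have "(E \<longlongrightarrow> 0) (at_right 0)" unfolding E_def using assms by real_asymp
    then show "((E \<circ> real_of_ereal) \<longlongrightarrow> 0) (at_right (ereal 0))" by (simp only: ereal_tendsto_simps)
    have "(E \<longlongrightarrow> E t) (at_left t)" using Et by (simp add: isCont_def filterlim_at_split)
    then show "((E \<circ> real_of_ereal) \<longlongrightarrow> E t) (at_left (ereal t))" by (simp only: ereal_tendsto_simps)
    fix s :: real assume s: "s \<in> einterval (ereal 0) (ereal t)"
    then show "0 \<le> - f s" unfolding f_def E_def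
      by (auto simp: divide_nonpos_nonneg mult_nonpos_nonneg)
    show "(E has_real_derivative - f s) (at s)" "isCont (\<lambda>s. - f s) s"
      using s dE by (auto intro: continuous_intros)
  qed (use assms in simp)
  moreover have "has_bochner_integral lborel (\<lambda>s. indicator (einterval (ereal t) \<infinity>) s * f s) (0 - (- E t))"
  proof (rule has_bochner_integral_FTC_nonneg)
    have "((\<lambda>s. - E s) \<longlongrightarrow> 0) at_top" unfolding E_def using assms by real_asymp
    then show "(((\<lambda>s. - E s) \<circ> real_of_ereal) \<longlongrightarrow> 0) (at_left \<infinity>)" by (simp only: ereal_tendsto_simps)
    have "((\<lambda>s. - E s) \<longlongrightarrow> - E t) (at_right t)" using Et
      by (intro tendsto_minus) (simp add: isCont_def filterlim_at_split)
    then show "(((\<lambda>s. - E s) \<circ> real_of_ereal) \<longlongrightarrow> - E t) (at_right (ereal t))" by (simp only: ereal_tendsto_simps)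
    fix s :: real assume s: "s \<in> einterval (ereal t) \<infinity>"
    then show "0 \<le> f s" using assms unfolding f_def E_def by auto
    show "((\<lambda>s. - E s) has_real_derivative f s) (at s)" "isCont f s"
      using s dE[of s] DERIV_minus[OF dE(1)[of s]] assms by auto
  qed simp
  \<comment> \<open>The rise of \<open>E\<close> on \<open>(0, t)\<close> and its fall beyond
    \<open>t\<close> each contribute \<open>E t = 1\<close>, hence the factor 2 below.\<close>
  ultimately have "has_bochner_integral lborel
     (\<lambda>s. indicator {0<..<t} s * - f s + indicator {t<..} s * f s) (E t - 0 + (0 - (- E t)))"
    unfolding einterval_eq by (rule has_bochner_integral_add)
  then have hb: "has_bochner_integral lborel
     (\<lambda>s. 2 / (sqrt pi * sqrt t) * (indicator {0<..<t} s * - f s + indicator {t<..} s * f s)) (2 / (sqrt pi * sqrt t) * 2)"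
    by (intro has_bochner_integral_mult_right) (simp_all add: E_def)
  have le: "hitting_density t s * (\<bar>s - t\<bar> / sqrt (s * t)) \<le>
      2 / (sqrt pi * sqrt t) * (indicator {0<..<t} s * - f s + indicator {t<..} s * f s)" for s
  proof (cases "0 < s")
    case True
    define r where "r = sqrt t"
    have r: "0 < r" "t = r * r" using assms by (auto simp: r_def)
    have fa: "indicator {0<..<t} s * - f s + indicator {t<..} s * f s = \<bar>s - t\<bar> * (s + t) / (4 * s\<^sup>2) * E s"
      using True by (auto simp: f_def indicator_def abs_if minus_mult_left minus_divide_left simp del: mult_minus_left)
    have "hitting_density t s * (\<bar>s - t\<bar> / sqrt (s * t)) = r / (2 * sqrt pi * s\<^sup>2) * \<bar>s - t\<bar> * E s"
    proof -
      have "t / (s * sqrt s) / sqrt (s * t) = r / s\<^sup>2"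
      proof -
        have "sqrt s * sqrt (s * t) = s * r" using True by (simp add: real_sqrt_mult r_def)
        then show ?thesis using r True by (simp add: field_simps power2_eq_square real_sqrt_mult r_def[symmetric])
      qed
      then have "\<bar>s - t\<bar> * E s / (2 * sqrt pi) * (t / (s * sqrt s) / sqrt (s * t)) = \<bar>s - t\<bar> * E s / (2 * sqrt pi) * (r / s\<^sup>2)" by simp
      then show ?thesis using True by (simp add: hitting_density_def E_def mult_ac)
    qed
    also have "\<dots> = 2 / (sqrt pi * r) * (\<bar>s - t\<bar> * t / (4 * s\<^sup>2) * E s)"
      using r by (simp add: field_simps)
    \<comment> \<open>The only loss in the pointwise bound is \<open>t \<le> s + t\<close>, which
      turns the integrand into a multiple of the modulus of the derivative of
      \<open>E\<close>.\<close>
    also have "\<dots> \<le> 2 / (sqrt pi * r) * (\<bar>s - t\<bar> * (s + t) / (4 * s\<^sup>2) * E s)"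
      using r True by (intro mult_left_mono mult_right_mono divide_right_mono) (auto simp: E_def)
    finally show ?thesis by (simp only: fa r_def)
  next
    case False
    then show ?thesis using assms by (simp add: hitting_density_eq_0)
  qed
  have nn: "0 \<le> hitting_density t s * (\<bar>s - t\<bar> / sqrt (s * t))" for s
    using hitting_density_nonneg[OF assms, of s] assms
    by (cases "0 < s") (auto simp: hitting_density_eq_0)
  show int: "integrable lborel (\<lambda>s. hitting_density t s * (\<bar>s - t\<bar> / sqrt (s * t)))"
  proof (rule Bochner_Integration.integrable_bound)
    show "AE s in lborel. norm (hitting_density t s * (\<bar>s - t\<bar> / sqrt (s * t))) \<le>
       norm (2 / (sqrt pi * sqrt t) * (indicator {0<..<t} s * - f s + indicator {t<..} s * f s))"
      using le nn by (intro AE_I2) (auto simp only: real_norm_def abs_of_nonneg intro: order_trans[OF _ abs_ge_self])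
  qed (use hb in \<open>auto simp: has_bochner_integral_iff\<close>)
  have "(LINT s|lborel. hitting_density t s * (\<bar>s - t\<bar> / sqrt (s * t))) \<le>
     (LINT s|lborel. 2 / (sqrt pi * sqrt t) * (indicator {0<..<t} s * - f s + indicator {t<..} s * f s))"
    using int hb le by (intro integral_mono) (auto simp only: has_bochner_integral_iff)
  also have "\<dots> = 4 / (sqrt pi * sqrt t)"
    using hb by (simp only: has_bochner_integral_iff)
  finally show "(LINT s|lborel. hitting_density t s * (\<bar>s - t\<bar> / sqrt (s * t))) \<le> 4 / (sqrt pi * sqrt t)" .
qed

section \<open>Maximum principle\<close>

text \<open>A relation rather than a function: existence and values of both derivatives at 0 travel
  together, so sums and multiples need no side conditions. The first derivative must exist near 0,
  the second only at 0.\<close>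

definition has_second_deriv :: "(real \<Rightarrow> real) \<Rightarrow> real \<Rightarrow> real \<Rightarrow> bool" where
  "has_second_deriv f a b \<longleftrightarrow> (\<exists>f'. (\<forall>\<^sub>F t in nhds 0. (f has_real_derivative f' t) (at t)) \<and>
     f' 0 = a \<and> (f' has_real_derivative b) (at 0))"

lemma has_second_deriv_add:
  assumes "has_second_deriv f a b" "has_second_deriv g c d"
  shows "has_second_deriv (\<lambda>t. f t + g t) (a + c) (b + d)"
proof -
  obtain f' g' where
    f: "\<forall>\<^sub>F t in nhds 0. (f has_real_derivative f' t) (at t)" "f' 0 = a" "(f' has_real_derivative b) (at 0)" and
    g: "\<forall>\<^sub>F t in nhds 0. (g has_real_derivative g' t) (at t)" "g' 0 = c" "(g' has_real_derivative d) (at 0)"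
    using assms unfolding has_second_deriv_def by blast
  have "\<forall>\<^sub>F t in nhds 0. ((\<lambda>t. f t + g t) has_real_derivative f' t + g' t) (at t)"
    using f(1) g(1) by eventually_elim (rule DERIV_add)
  moreover have "((\<lambda>t. f' t + g' t) has_real_derivative b + d) (at 0)"
    using f(3) g(3) by (rule DERIV_add)
  ultimately show ?thesis unfolding has_second_deriv_def using f(2) g(2)
    by (intro exI[of _ "\<lambda>t. f' t + g' t"]) auto
qed

lemma has_second_deriv_cmult:
  assumes "has_second_deriv f a b"
  shows "has_second_deriv (\<lambda>t. c * f t) (c * a) (c * b)"
proof -
  obtain f' where
    f: "\<forall>\<^sub>F t in nhds 0. (f has_real_derivative f' t) (at t)" "f' 0 = a" "(f' has_real_derivative b) (at 0)"
    using assms unfolding has_second_deriv_def by blast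
  have "\<forall>\<^sub>F t in nhds 0. ((\<lambda>t. c * f t) has_real_derivative c * f' t) (at t)"
    using f(1) by eventually_elim (rule DERIV_cmult)
  moreover have "((\<lambda>t. c * f' t) has_real_derivative c * b) (at 0)"
    using f(3) by (rule DERIV_cmult)
  ultimately show ?thesis unfolding has_second_deriv_def using f(2)
    by (intro exI[of _ "\<lambda>t. c * f' t"]) auto
qed

text \<open>If \<open>b\<close> were positive, \<open>f'\<close> would be positive just to the right
  of its zero at 0, so \<open>f\<close> would increase strictly there, against maximality.\<close>

lemma has_second_deriv_local_max:
  assumes "has_second_deriv f a b" and max: "\<forall>\<^sub>F t in nhds 0. f t \<le> f 0"
  shows "a = 0" and "b \<le> 0"
proof -
  obtain f' where
    f: "\<forall>\<^sub>F t in nhds 0. (f has_real_derivative f' t) (at t)" "f' 0 = a" "(f' has_real_derivative b) (at 0)"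
    using assms unfolding has_second_deriv_def by blast
  obtain d where "0 < d" "\<forall>t. dist t 0 < d \<longrightarrow> (f has_real_derivative f' t) (at t) \<and> f t \<le> f 0"
    using eventually_conj[OF f(1) max] unfolding eventually_nhds_metric by blast
  then have d: "0 < d" "\<And>t. \<bar>t\<bar> < d \<Longrightarrow> (f has_real_derivative f' t) (at t) \<and> f t \<le> f 0"
    by (simp_all add: dist_real_def)
  show a: "a = 0"
  proof -
    have "f' 0 = 0"
    proof (rule DERIV_local_max[OF _ d(1)])
      show "(f has_real_derivative f' 0) (at 0)" using d(2)[of 0] d(1) by simp
      show "\<forall>y. \<bar>0 - y\<bar> < d \<longrightarrow> f y \<le> f 0" using d(2) by simp
    qed
    then show ?thesis using f(2) by simp
  qed
  show "b \<le> 0"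
  proof (rule ccontr)
    assume "\<not> b \<le> 0"
    then have "0 < b" by simp
    from DERIV_pos_inc_right[OF f(3) this]
    obtain e where e: "0 < e" "\<forall>h>0. h < e \<longrightarrow> f' 0 < f' (0 + h)" by blast
    define h where "h = min d e / 2"
    have h: "0 < h" "h < d" "h < e" using d(1) e(1) by (auto simp: h_def min_def)
    have "f 0 < f h"
    proof (rule DERIV_pos_imp_increasing_open[OF h(1)])
      fix x assume x: "0 < x" "x < h"
      then have "f' 0 < f' (0 + x)" using e(2) h by auto
      then have "0 < f' x" using f(2) a by simp
      moreover have "(f has_real_derivative f' x) (at x)" using d(2)[of x] x h by linarith
      ultimately show "\<exists>y. (f has_real_derivative y) (at x) \<and> 0 < y" by blast
    next
      have "(f has_real_derivative f' x) (at x within {0..h})" if "x \<in> {0..h}" for x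
      proof (rule has_field_derivative_at_within)
        have "\<bar>x\<bar> < d" using that h by (simp only: atLeastAtMost_iff) linarith
        then show "(f has_real_derivative f' x) (at x)" using d(2) by blast
      qed
      then show "continuous_on {0..h} f" by (rule DERIV_continuous_on)
    qed
    moreover have "\<bar>h\<bar> < d" using h by linarith
    ultimately show False using d(2)[of h] by linarith
  qed
qed

text \<open>Relational counterpart of \<open>drift_laplacian\<close>: it also asserts that the
  derivatives involved exist, and it is linear by construction.\<close>

definition has_drift_laplacian :: "(real \<times> real \<Rightarrow> real) \<Rightarrow> real \<times> real \<Rightarrow> real \<Rightarrow> bool" where
  "has_drift_laplacian u p l \<longleftrightarrow> (\<exists>a b c d. has_second_deriv (\<lambda>t. u (p + t *\<^sub>R e2)) a b \<and>
     has_second_deriv (\<lambda>t. u (p + t *\<^sub>R e3)) c d \<and> l = b + d + c)"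

lemma has_drift_laplacian_add:
  assumes "has_drift_laplacian u p k" "has_drift_laplacian v p l"
  shows "has_drift_laplacian (\<lambda>q. u q + v q) p (k + l)"
proof -
  obtain a b c d where u: "has_second_deriv (\<lambda>t. u (p + t *\<^sub>R e2)) a b"
     "has_second_deriv (\<lambda>t. u (p + t *\<^sub>R e3)) c d" "k = b + d + c"
    using assms(1) unfolding has_drift_laplacian_def by blast
  obtain a' b' c' d' where v: "has_second_deriv (\<lambda>t. v (p + t *\<^sub>R e2)) a' b'"
     "has_second_deriv (\<lambda>t. v (p + t *\<^sub>R e3)) c' d'" "l = b' + d' + c'"
    using assms(2) unfolding has_drift_laplacian_def by blast
  have "k + l = (b + b') + (d + d') + (c + c')" using u v by simp
  with has_second_deriv_add[OF u(1) v(1)] has_second_deriv_add[OF u(2) v(2)] show ?thesis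
    unfolding has_drift_laplacian_def by blast
qed

lemma has_drift_laplacian_cmult:
  assumes "has_drift_laplacian u p k"
  shows "has_drift_laplacian (\<lambda>q. r * u q) p (r * k)"
proof -
  obtain a b c d where u: "has_second_deriv (\<lambda>t. u (p + t *\<^sub>R e2)) a b"
     "has_second_deriv (\<lambda>t. u (p + t *\<^sub>R e3)) c d" "k = b + d + c"
    using assms(1) unfolding has_drift_laplacian_def by blast
  have "r * k = r * b + r * d + r * c" using u by (simp add: algebra_simps)
  with has_second_deriv_cmult[OF u(1)] has_second_deriv_cmult[OF u(2)] show ?thesis
    unfolding has_drift_laplacian_def by blast
qed

section \<open>Comparison of solutions on the half plane\<close>

lemma Omega0_eq: "Omega0 = UNIV \<times> {..<0}"
  by (auto simp: Omega0_def)

lemma closure_Omega0: "closure Omega0 = {p. snd p \<le> 0}"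
proof -
  have "closure Omega0 = UNIV \<times> {..0}"
    unfolding Omega0_eq closure_Times by (subst closure_UNIV, subst closure_lessThan) simp
  also have "\<dots> = {p. snd p \<le> 0}" by auto
  finally show ?thesis .
qed

lemma open_Omega0: "open Omega0"
  unfolding Omega0_eq by (intro open_Times open_UNIV open_lessThan)

lemma eventually_line_in_open:
  fixes p v :: "'a::real_normed_vector"
  assumes "open S" "p \<in> S"
  shows "\<forall>\<^sub>F t in nhds 0. p + t *\<^sub>R v \<in> S"
proof -
  have "((\<lambda>t. p + t *\<^sub>R v) \<longlongrightarrow> p + 0 *\<^sub>R v) (nhds 0)"
    by (intro tendsto_add tendsto_const tendsto_scaleR filterlim_ident)
  from topological_tendstoD[OF this assms(1)] show ?thesis using assms(2) by simp
qed

text \<open>A positive value would force a positive maximum over a large rectangle. The quadratic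
  decay keeps it off the lateral and lower edges and \<open>bdry\<close> off the upper one. At an
  interior maximum the first derivatives vanish and the second ones are at most 0, against
  \<open>l > 0\<close>.\<close>

lemma max_principle_half_plane:
  fixes z :: "real \<times> real \<Rightarrow> real"
  assumes cont: "continuous_on {p. snd p \<le> 0} z"
    and pos: "\<And>p. p \<in> Omega0 \<Longrightarrow> \<exists>l>0. has_drift_laplacian z p l"
    and bdry: "\<And>x. z (x, 0) \<le> 0"
    and decay: "\<And>x y. y \<le> 0 \<Longrightarrow> z (x, y) \<le> A - K * (x\<^sup>2 - 3 * y)" and "0 < K"
    and "q \<in> Omega0"
  shows "z q \<le> 0"
proof (rule ccontr)
  assume neg: "\<not> z q \<le> 0"
  \<comment> \<open>At a positive maximum \<open>decay\<close> gives
    \<open>K * (x^2 - 3 * y) < \<bar>A\<bar> + 1 \<le> K * R\<close>. With \<open>R \<ge> 1\<close>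
    this implies \<open>\<bar>x\<bar> < R\<close> and \<open>- R < y\<close>. The last two summands
    place \<open>q\<close> in the rectangle.\<close>
  define R where "R = (\<bar>A\<bar> + 1) / K + 1 + \<bar>fst q\<bar> + \<bar>snd q\<bar>"
  define S where "S = {- R .. R} \<times> {- R .. 0}"
  have R1: "1 \<le> R" using \<open>0 < K\<close> by (simp add: R_def)
  have "(\<bar>A\<bar> + 1) / K \<le> R" by (simp add: R_def)
  then have R2: "\<bar>A\<bar> + 1 \<le> K * R" using \<open>0 < K\<close> by (simp add: field_simps)
  have "0 \<le> (\<bar>A\<bar> + 1) / K" using \<open>0 < K\<close> by simp
  then have qS: "q \<in> S" using assms(6)
    by (cases q) (auto simp: S_def R_def Omega0_def)
  have "compact S" by (simp add: S_def compact_Times)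
  moreover have "continuous_on S z" by (rule continuous_on_subset[OF cont]) (auto simp: S_def)
  ultimately obtain m where m: "m \<in> S" "\<And>r. r \<in> S \<Longrightarrow> z r \<le> z m"
    using continuous_attains_sup[of S z] qS by blast
  have zm: "0 < z m" using m(2)[OF qS] neg by linarith
  obtain x y where xy: "m = (x, y)" by (cases m)
  have "K * (x\<^sup>2 - 3 * y) < K * R"
  proof -
    have "y \<le> 0" using m(1) by (auto simp: S_def xy)
    then show ?thesis using decay[of y x] zm R2 unfolding xy by linarith
  qed
  then have le: "x\<^sup>2 - 3 * y < R" using \<open>0 < K\<close> by simp
  have y: "y < 0" using m(1) zm bdry[of x] unfolding S_def xy by (cases "y = 0") auto
  have "R \<le> R\<^sup>2" using R1 by (intro self_le_power) auto
  then have "\<bar>x\<bar>\<^sup>2 < R\<^sup>2" using le y by simp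
  then have x: "\<bar>x\<bar> < R" using R1 by (intro power2_less_imp_less[of "\<bar>x\<bar>" R]) auto
  have y2: "- R < y" using le R1 zero_le_power2[of x] by linarith
  have "open ({- R<..<R} \<times> {- R<..<0})" by (simp add: open_Times)
  moreover have "m \<in> {- R<..<R} \<times> {- R<..<0}" using x y y2 by (auto simp: xy)
  ultimately have ev: "\<forall>\<^sub>F t in nhds 0. m + t *\<^sub>R v \<in> {- R<..<R} \<times> {- R<..<0}" for v
    by (rule eventually_line_in_open)
  have ev2: "\<forall>\<^sub>F t in nhds 0. z (m + t *\<^sub>R v) \<le> z (m + 0 *\<^sub>R v)" for v
    using ev[of v]
  proof eventually_elim
    case (elim t)
    then have "m + t *\<^sub>R v \<in> S" by (auto simp: S_def)
    then show ?case using m(2) by simp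
  qed
  have "m \<in> Omega0" using y by (simp add: xy Omega0_def)
  then obtain l a b c d where l: "0 < l" "has_second_deriv (\<lambda>t. z (m + t *\<^sub>R e2)) a b"
     "has_second_deriv (\<lambda>t. z (m + t *\<^sub>R e3)) c d" "l = b + d + c"
    using pos unfolding has_drift_laplacian_def by blast
  show False
    using has_second_deriv_local_max[OF l(2) ev2] has_second_deriv_local_max[OF l(3) ev2] l by simp
qed

text \<open>The second derivative of \<open>x2^2\<close> contributes 2 and the drift acting on
  \<open>- 3 * x3\<close> contributes -3. The coefficient 3 exceeds 2, so the sign is strict, while
  the barrier stays nonnegative on the half plane.\<close>

lemma barrier_drift_laplacian: "has_drift_laplacian (\<lambda>p. C + D * ((fst p)\<^sup>2 - 3 * snd p)) p (- D)"
proof -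
  have "has_second_deriv (\<lambda>t. C + D * ((fst (p + t *\<^sub>R e2))\<^sup>2 - 3 * snd (p + t *\<^sub>R e2))) (2 * D * fst p) (2 * D)"
    unfolding has_second_deriv_def e2_def
    by (rule exI[of _ "\<lambda>t. 2 * D * (fst p + t)"]) (auto intro!: always_eventually derivative_eq_intros)
  moreover have "has_second_deriv (\<lambda>t. C + D * ((fst (p + t *\<^sub>R e3))\<^sup>2 - 3 * snd (p + t *\<^sub>R e3))) (- 3 * D) 0"
    unfolding has_second_deriv_def e3_def
    by (rule exI[of _ "\<lambda>t. - 3 * D"]) (auto intro!: always_eventually derivative_eq_intros)
  moreover have "- D = 2 * D + 0 + (- 3 * D)" by simp
  ultimately show ?thesis unfolding has_drift_laplacian_def by blast
qed

text \<open>The maximum principle is applied to \<open>u - v\<close> minus \<open>\<epsilon>\<close>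
  and \<open>K\<close> times the barrier. Its drift Laplacian is \<open>K > 0\<close>, and the
  one-sided bounds on \<open>u\<close> and \<open>- v\<close> provide the decay.\<close>

lemma comparison_half_plane:
  fixes u v :: "real \<times> real \<Rightarrow> real"
  assumes "continuous_on {p. snd p \<le> 0} u" "continuous_on {p. snd p \<le> 0} v"
    and u: "\<And>p. p \<in> Omega0 \<Longrightarrow> has_drift_laplacian u p 0"
    and v: "\<And>p. p \<in> Omega0 \<Longrightarrow> has_drift_laplacian v p 0"
    and bdd: "\<And>p. snd p \<le> 0 \<Longrightarrow> u p \<le> A" "\<And>p. snd p \<le> 0 \<Longrightarrow> - v p \<le> B"
    and bdry: "\<And>x. u (x, 0) - v (x, 0) \<le> \<epsilon> + K * x\<^sup>2" and "0 < K" "y < 0"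
  shows "u (x, y) - v (x, y) \<le> \<epsilon> + K * (x\<^sup>2 - 3 * y)"
proof -
  define z where "z = (\<lambda>p. u p + (- 1 * v p + (- \<epsilon> + (- K) * ((fst p)\<^sup>2 - 3 * snd p))))"
  have "z (x, y) \<le> 0"
  proof (rule max_principle_half_plane[where z=z and A="A + B - \<epsilon>" and K=K])
    show "continuous_on {p. snd p \<le> 0} z"
      unfolding z_def by (intro continuous_intros assms)
    fix p :: "real \<times> real" assume p: "p \<in> Omega0"
    have "has_drift_laplacian z p (0 + (- 1 * 0 + - (- K)))"
      unfolding z_def
      by (rule has_drift_laplacian_add[OF u[OF p]
            has_drift_laplacian_add[OF has_drift_laplacian_cmult[OF v[OF p]] barrier_drift_laplacian]])
    then show "\<exists>l>0. has_drift_laplacian z p l" using \<open>0 < K\<close> by auto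
  next
    fix x show "z (x, 0) \<le> 0" using bdry[of x] by (simp add: z_def)
  next
    fix x y :: real assume "y \<le> 0"
    then show "z (x, y) \<le> A + B - \<epsilon> - K * (x\<^sup>2 - 3 * y)"
      using bdd[of "(x, y)"] by (simp add: z_def)
  qed (use \<open>0 < K\<close> \<open>y < 0\<close> in \<open>simp_all add: Omega0_def\<close>)
  then show ?thesis by (simp add: z_def)
qed

section \<open>From regularity on the closure to derivatives along lines\<close>

text \<open>\<open>partial_deriv\<close> always differentiates at parameter 0. Shifting the
  parameter along the line turns the values at nearby points of \<open>S\<close> into derivatives of
  one function of \<open>t\<close>.\<close>

lemma Ck_closure_second_deriv:
  assumes ck: "Ck_closure 2 S u" and "open S" "p \<in> S" "b \<in> Basis"
  shows "has_second_deriv (\<lambda>t. u (p + t *\<^sub>R b)) (partial_deriv b u p) (partial_deriv b (partial_deriv b u) p)"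
proof -
  have d: "\<And>q. q \<in> S \<Longrightarrow> has_partial_deriv_at b u q"
    "\<And>q. q \<in> S \<Longrightarrow> has_partial_deriv_at b (partial_deriv b u) q"
    using ck \<open>b \<in> Basis\<close> by (simp_all add: Ck_closure_def numeral_2_eq_2)
  have D: "((\<lambda>t. f (q + t *\<^sub>R b)) has_real_derivative partial_deriv b f q) (at 0)"
    if "has_partial_deriv_at b f q" for f q
    using that by (simp add: has_partial_deriv_at_def partial_deriv_def DERIV_deriv_iff_real_differentiable)
  have "\<forall>\<^sub>F t in nhds 0. p + t *\<^sub>R b \<in> S"
    by (rule eventually_line_in_open[OF \<open>open S\<close> \<open>p \<in> S\<close>])
  then have "\<forall>\<^sub>F t in nhds 0. ((\<lambda>t. u (p + t *\<^sub>R b)) has_real_derivative partial_deriv b u (p + t *\<^sub>R b)) (at t)"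
  proof eventually_elim
    case (elim t)
    have "((\<lambda>h. u (p + t *\<^sub>R b + h *\<^sub>R b)) has_real_derivative partial_deriv b u (p + t *\<^sub>R b)) (at 0)"
      by (rule D[OF d(1)[OF elim]])
    then show ?case
      using DERIV_shift[of "\<lambda>t. u (p + t *\<^sub>R b)" _ 0 t] by (simp add: algebra_simps)
  qed
  then show ?thesis unfolding has_second_deriv_def
    using D[OF d(2)[OF \<open>p \<in> S\<close>]] by (intro exI[of _ "\<lambda>t. partial_deriv b u (p + t *\<^sub>R b)"]) auto
qed

lemma Ck_closure_has_drift_laplacian:
  assumes "Ck_closure 2 Omega0 u" "p \<in> Omega0"
  shows "has_drift_laplacian u p (drift_laplacian u p)"
proof -
  have "e2 \<in> Basis" "e3 \<in> Basis" by (auto simp: e2_def e3_def Basis_prod_def)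
  then show ?thesis
    using Ck_closure_second_deriv[OF assms(1) open_Omega0 assms(2)]
    unfolding has_drift_laplacian_def drift_laplacian_def by blast
qed

section \<open>Trigonometric boundary data\<close>

text \<open>The phase \<open>\<theta>\<close> covers sines and \<open>k = 0\<close> covers
  constants, so one generator suffices for inductions. Frequencies may be arbitrary reals.\<close>

inductive trig_poly :: "(real \<Rightarrow> real) \<Rightarrow> bool" where
  cos: "trig_poly (\<lambda>x. a * cos (k * x + \<theta>))"
| add: "trig_poly p \<Longrightarrow> trig_poly q \<Longrightarrow> trig_poly (\<lambda>x. p x + q x)"

lemma trig_poly_const: "trig_poly (\<lambda>x. a)"
  using trig_poly.cos[of a 0 0] by simp

text \<open>The product-to-sum formula for cosines keeps products within the class.\<close>

lemma trig_poly_cos_mult: "trig_poly q \<Longrightarrow> trig_poly (\<lambda>x. a * cos (k * x + \<theta>) * q x)"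
proof (induction rule: trig_poly.induct)
  case (cos b l \<eta>)
  have "(\<lambda>x. a * cos (k * x + \<theta>) * (b * cos (l * x + \<eta>))) =
    (\<lambda>x. (a * b / 2) * cos ((k - l) * x + (\<theta> - \<eta>)) + (a * b / 2) * cos ((k + l) * x + (\<theta> + \<eta>)))"
  proof
    fix x
    have 1: "(k - l) * x + (\<theta> - \<eta>) = (k * x + \<theta>) - (l * x + \<eta>)"
         "(k + l) * x + (\<theta> + \<eta>) = (k * x + \<theta>) + (l * x + \<eta>)"
      by (simp_all add: algebra_simps)
    show "a * cos (k * x + \<theta>) * (b * cos (l * x + \<eta>)) =
     (a * b / 2) * cos ((k - l) * x + (\<theta> - \<eta>)) + (a * b / 2) * cos ((k + l) * x + (\<theta> + \<eta>))"
      unfolding 1 cos_add cos_diff by (simp add: algebra_simps)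
  qed
  then show ?case by (simp only: trig_poly.add trig_poly.cos)
next
  case (add p q)
  then show ?case by (simp only: distrib_left trig_poly.add)
qed

lemma trig_poly_mult: "trig_poly p \<Longrightarrow> trig_poly q \<Longrightarrow> trig_poly (\<lambda>x. p x * q x)"
proof (induction rule: trig_poly.induct)
  case (cos a k \<theta>)
  then show ?case by (rule trig_poly_cos_mult)
next
  case (add p p')
  then show ?case by (simp only: distrib_right trig_poly.add)
qed

text \<open>A sine is a cosine with phase \<open>- pi / 2\<close>, and the class contains constants
  and is closed under sums and products.\<close>

lemma trig_poly_polynomial_sin:
  assumes "real_polynomial_function (q :: real \<Rightarrow> real)"
  shows "trig_poly (\<lambda>x. q (sin (\<omega> * x)))"
  using assms
proof (induction rule: real_polynomial_function.induct)
  case (linear f)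
  then obtain c where "f = (\<lambda>x. x * c)" by (auto simp: real_bounded_linear)
  moreover have "(\<lambda>x. sin (\<omega> * x) * c) = (\<lambda>x. c * cos (\<omega> * x + - pi / 2))"
    by (simp add: fun_eq_iff cos_diff)
  ultimately show ?case using trig_poly.cos[of c \<omega> "- pi / 2"] by simp
qed (auto intro: trig_poly_const trig_poly.add trig_poly_mult)

lemma trig_poly_continuous: "trig_poly p \<Longrightarrow> continuous_on UNIV p"
  by (induction rule: trig_poly.induct) (auto intro!: continuous_intros)

lemma trig_poly_bounded: "trig_poly p \<Longrightarrow> \<exists>B. \<forall>x. \<bar>p x\<bar> \<le> B"
proof (induction rule: trig_poly.induct)
  case (cos a k \<theta>)
  have "\<bar>a * cos (k * x + \<theta>)\<bar> \<le> \<bar>a\<bar>" for x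
    using mult_left_mono[OF abs_cos_le_one, of "\<bar>a\<bar>" "k * x + \<theta>"] by (simp add: abs_mult)
  then show ?case by blast
next
  case (add p q)
  then obtain A B where "\<And>x. \<bar>p x\<bar> \<le> A" "\<And>x. \<bar>q x\<bar> \<le> B" by blast
  then have "\<bar>p x + q x\<bar> \<le> A + B" for x by (rule order_trans[OF abs_triangle_ineq add_mono])
  then show ?case by blast
qed

text \<open>Approximating \<open>f (arcsin s / \<omega>)\<close> by an algebraic polynomial in \<open>s = sin (\<omega> * x)\<close> gives the global
  bound for free.\<close>

lemma trig_poly_approx:
  fixes f :: "real \<Rightarrow> real"
  assumes f: "continuous_on UNIV f" "\<And>x. \<bar>f x\<bar> \<le> M" and "0 < \<epsilon>" "0 < R"
  obtains p where "trig_poly p" "\<And>x. \<bar>p x\<bar> \<le> M + \<epsilon>" "\<And>x. \<bar>x\<bar> \<le> R \<Longrightarrow> \<bar>f x - p x\<bar> \<le> \<epsilon>"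
proof -
  \<comment> \<open>This scale maps \<open>[-R, R]\<close> onto \<open>[-pi/2, pi/2]\<close>, where
    \<open>arcsin\<close> inverts \<open>sin\<close>.\<close>
  define \<omega> where "\<omega> = pi / (2 * R)"
  have \<omega>: "0 < \<omega>" using \<open>0 < R\<close> by (simp add: \<omega>_def)
  have "continuous_on {-1..1} (\<lambda>s. f (arcsin s / \<omega>))"
    by (rule continuous_on_compose2[OF f(1)]) (use \<omega> in \<open>auto intro!: continuous_intros\<close>)
  then obtain q where q: "real_polynomial_function q" "\<And>s. s \<in> {-1..1} \<Longrightarrow> \<bar>f (arcsin s / \<omega>) - q s\<bar> < \<epsilon>"
    using Stone_Weierstrass_real_polynomial_function[of "{-1..1::real}" "\<lambda>s. f (arcsin s / \<omega>)" \<epsilon>] \<open>0 < \<epsilon>\<close>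
    by auto
  show ?thesis
  proof (rule that[of "\<lambda>x. q (sin (\<omega> * x))"])
    show "trig_poly (\<lambda>x. q (sin (\<omega> * x)))" by (rule trig_poly_polynomial_sin[OF q(1)])
    fix x
    have qs: "\<bar>f (arcsin (sin (\<omega> * x)) / \<omega>) - q (sin (\<omega> * x))\<bar> < \<epsilon>" by (rule q(2)) simp
    then show "\<bar>q (sin (\<omega> * x))\<bar> \<le> M + \<epsilon>"
      using f(2)[of "arcsin (sin (\<omega> * x)) / \<omega>"] by linarith
    assume "\<bar>x\<bar> \<le> R"
    then have "\<omega> * \<bar>x\<bar> \<le> \<omega> * R" using \<omega> by simp
    also have "\<omega> * R = pi / 2" using \<open>0 < R\<close> by (simp add: \<omega>_def)
    finally have "\<bar>\<omega> * x\<bar> \<le> pi / 2" using \<omega> by (simp add: abs_mult)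
    then have "arcsin (sin (\<omega> * x)) = \<omega> * x" by (intro arcsin_sin) auto
    then show "\<bar>f x - q (sin (\<omega> * x))\<bar> \<le> \<epsilon>" using qs \<omega> by simp
  qed
qed

section \<open>The subordination formula\<close>

text \<open>Joins what comparison needs (a bounded solution, continuous up to the boundary, with
  data \<open>p\<close>) to the representation as an average of the heat flow over the exit
  time.\<close>

definition subordinated :: "(real \<Rightarrow> real) \<Rightarrow> (real \<times> real \<Rightarrow> real) \<Rightarrow> bool" where
  "subordinated p V \<longleftrightarrow> continuous_on {q. snd q \<le> 0} V \<and>
     (\<forall>q\<in>Omega0. has_drift_laplacian V q 0) \<and>
     (\<exists>B. \<forall>q. snd q \<le> 0 \<longrightarrow> \<bar>V q\<bar> \<le> B) \<and>
     (\<forall>x. V (x, 0) = p x) \<and>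
     (\<forall>x t. 0 < t \<longrightarrow>
       has_bochner_integral lborel (\<lambda>s. hitting_density t s * heat s p x) (V (x, - t)))"

text \<open>Separation of variables gives \<open>V\<close>, where \<open>l\<close> is the
  nonnegative root of \<open>l^2 + l = k^2\<close>. As \<open>heat\<close> multiplies the cosine by
  \<open>exp (- k^2 * s)\<close>, the formula is the Laplace transform of
  \<open>hitting_density\<close> at \<open>k^2\<close>.\<close>

lemma subordinated_cos: "\<exists>V. subordinated (\<lambda>x. a * cos (k * x + \<theta>)) V"
proof -
  define l where "l = decay_rate (k\<^sup>2)"
  have l: "l\<^sup>2 + l = k\<^sup>2" "0 \<le> l" by (simp_all add: l_def decay_rate_eq decay_rate_nonneg)
  define V where "V = (\<lambda>q::real \<times> real. a * exp (l * snd q) * cos (k * fst q + \<theta>))"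
  have "continuous_on {q. snd q \<le> 0} V" unfolding V_def by (intro continuous_intros)
  moreover have "has_drift_laplacian V q 0" for q
  proof -
    have "has_second_deriv (\<lambda>t. V (q + t *\<^sub>R e2)) (- a * k * exp (l * snd q) * sin (k * fst q + \<theta>)) (- k\<^sup>2 * V q)"
      unfolding has_second_deriv_def e2_def V_def
      by (rule exI[of _ "\<lambda>t. - a * k * exp (l * snd q) * sin (k * (fst q + t) + \<theta>)"])
        (auto intro!: always_eventually derivative_eq_intros simp: power2_eq_square)
    moreover have "has_second_deriv (\<lambda>t. V (q + t *\<^sub>R e3)) (l * V q) (l\<^sup>2 * V q)"
      unfolding has_second_deriv_def e3_def V_def
      by (rule exI[of _ "\<lambda>t. l * (a * exp (l * (snd q + t)) * cos (k * fst q + \<theta>))"])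
        (auto intro!: always_eventually derivative_eq_intros simp: power2_eq_square)
    moreover have "0 = - k\<^sup>2 * V q + l\<^sup>2 * V q + l * V q" using l(1) by (simp add: algebra_simps flip: l(1))
    ultimately show ?thesis unfolding has_drift_laplacian_def by blast
  qed
  moreover have "\<bar>V q\<bar> \<le> \<bar>a\<bar>" if "snd q \<le> 0" for q
  proof -
    have "exp (l * snd q) \<le> 1" using that l by (simp add: mult_nonneg_nonpos)
    then have "\<bar>a\<bar> * exp (l * snd q) * \<bar>cos (k * fst q + \<theta>)\<bar> \<le> \<bar>a\<bar> * 1 * 1"
      by (intro mult_mono) auto
    then show ?thesis by (simp add: V_def abs_mult)
  qed
  moreover have "has_bochner_integral lborel
     (\<lambda>s. hitting_density t s * heat s (\<lambda>x. a * cos (k * x + \<theta>)) x) (V (x, - t))" if t: "0 < t" for x t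
  proof -
    have "hitting_density t s * heat s (\<lambda>x. a * cos (k * x + \<theta>)) x =
       a * cos (k * x + \<theta>) * (hitting_density t s * exp (- (k\<^sup>2) * s))" for s
    proof (cases "0 < s")
      case True
      have "heat s (\<lambda>x. a * cos (k * x + \<theta>)) x = a * heat s (\<lambda>x. cos (k * x + \<theta>)) x"
        unfolding heat_def by (simp add: mult.left_commute)
      also have "heat s (\<lambda>x. cos (k * x + \<theta>)) x = exp (- k\<^sup>2 * s) * cos (k * x + \<theta>)"
        by (rule heat_cos[OF True])
      finally show ?thesis by (simp add: mult_ac)
    qed (simp add: hitting_density_eq_0)
    moreover have "V (x, - t) = a * cos (k * x + \<theta>) * exp (- l * t)" by (simp add: V_def)
    ultimately show ?thesis
      using has_bochner_integral_mult_right[where c = "a * cos (k * x + \<theta>)", OF hitting_density_laplace[OF t, of "k\<^sup>2"]]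
      by (simp only: l_def zero_le_power2 simp_thms)
  qed
  moreover have "V (x, 0) = a * cos (k * x + \<theta>)" for x by (simp add: V_def)
  ultimately have "subordinated (\<lambda>x. a * cos (k * x + \<theta>)) V"
    unfolding subordinated_def by blast
  then show ?thesis by blast
qed

text \<open>All clauses of \<open>subordinated\<close> are additive; boundedness of trigonometric
  polynomials supplies the integrability for splitting \<open>heat\<close>.\<close>

lemma trig_poly_subordinated: "trig_poly p \<Longrightarrow> \<exists>V. subordinated p V"
proof (induction rule: trig_poly.induct)
  case (cos a k \<theta>)
  show ?case by (rule subordinated_cos)
next
  case (add p q)
  then obtain V W where V: "subordinated p V" and W: "subordinated q W" by blast
  obtain A B where AB: "\<And>q. snd q \<le> 0 \<Longrightarrow> \<bar>V q\<bar> \<le> A" "\<And>q. snd q \<le> 0 \<Longrightarrow> \<bar>W q\<bar> \<le> B"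
    using V W unfolding subordinated_def by blast
  have heat_add: "hitting_density t s * heat s (\<lambda>x. p x + q x) x =
     hitting_density t s * heat s p x + hitting_density t s * heat s q x" for s t x
  proof (cases "0 < s")
    case True
    have "integrable lborel (\<lambda>y. normal_density x (sqrt (2 * s)) y * r y)" if r: "trig_poly r" for r
    proof -
      obtain C where "\<And>x. \<bar>r x\<bar> \<le> C" using trig_poly_bounded[OF r] by blast
      then show ?thesis
        using True r by (intro integrable_heat) (auto intro: borel_measurable_continuous_onI trig_poly_continuous)
    qed
    then have "heat s (\<lambda>x. p x + q x) x = heat s p x + heat s q x"
      using add.hyps by (simp add: heat_def distrib_left)
    then show ?thesis by (simp add: distrib_left)
  qed (simp add: hitting_density_eq_0)
  have "subordinated (\<lambda>x. p x + q x) (\<lambda>r. V r + W r)"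
    unfolding subordinated_def
  proof (intro conjI ballI allI impI)
    show "continuous_on {q. snd q \<le> 0} (\<lambda>r. V r + W r)"
      using V W by (auto simp: subordinated_def intro!: continuous_intros)
    show "has_drift_laplacian (\<lambda>r. V r + W r) r 0" if "r \<in> Omega0" for r
      using has_drift_laplacian_add[of V r 0 W 0] V W that by (simp add: subordinated_def)
    show "\<exists>B. \<forall>r. snd r \<le> 0 \<longrightarrow> \<bar>V r + W r\<bar> \<le> B"
      using AB by (intro exI[of _ "A + B"]) (auto intro: order_trans[OF abs_triangle_ineq add_mono])
    show "V (x, 0) + W (x, 0) = p x + q x" for x
      using V W by (simp add: subordinated_def)
    show "has_bochner_integral lborel (\<lambda>s. hitting_density t s * heat s (\<lambda>x. p x + q x) x)
         (V (x, - t) + W (x, - t))" if "0 < t" for x t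
      unfolding heat_add using V W that by (auto simp: subordinated_def intro!: has_bochner_integral_add)
  qed
  then show ?case by blast
qed

section \<open>Error estimates and passage to general boundary data\<close>

text \<open>The exit law has mass 1, so the error is the average over \<open>s\<close> of
  \<open>heat s p x - heat t p x\<close>. The Lipschitz-type bound on the semigroup reduces it to
  the mean deviation of the exit time.\<close>

lemma subordinated_heat_estimate:
  assumes V: "subordinated p V" and p: "p \<in> borel_measurable borel" "\<And>x. \<bar>p x\<bar> \<le> M" and t: "0 < t"
  shows "\<bar>V (x, - t) - heat t p x\<bar> \<le> M * (4 / (sqrt pi * sqrt t))"
proof -
  have M: "0 \<le> M" using p(2)[of 0] by linarith
  have 1: "has_bochner_integral lborel (\<lambda>s. hitting_density t s * heat s p x) (V (x, - t))"
    using V t by (simp add: subordinated_def)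
  \<comment> \<open>The total mass is the Laplace transform at 0, since
    \<open>decay_rate 0 = 0\<close>.\<close>
  have "has_bochner_integral lborel (hitting_density t) 1"
    using hitting_density_laplace[OF t, of 0] by (simp add: decay_rate_def)
  then have "has_bochner_integral lborel (\<lambda>s. hitting_density t s * heat t p x) (1 * heat t p x)"
    by (intro has_bochner_integral_mult_left) auto
  from has_bochner_integral_diff[OF 1 this]
  have 2: "has_bochner_integral lborel (\<lambda>s. hitting_density t s * (heat s p x - heat t p x))
     (V (x, - t) - heat t p x)" by (simp add: right_diff_distrib)
  have "\<bar>V (x, - t) - heat t p x\<bar> = \<bar>LINT s|lborel. hitting_density t s * (heat s p x - heat t p x)\<bar>"
    using 2 by (simp add: has_bochner_integral_iff)
  also have "\<dots> \<le> (LINT s|lborel. M * (hitting_density t s * (\<bar>s - t\<bar> / sqrt (s * t))))"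
  proof (rule integral_abs_bound_integral)
    show "integrable lborel (\<lambda>s. hitting_density t s * (heat s p x - heat t p x))"
      using 2 by (simp add: has_bochner_integral_iff)
    show "integrable lborel (\<lambda>s. M * (hitting_density t s * (\<bar>s - t\<bar> / sqrt (s * t))))"
      using hitting_density_abs_deviation(1)[OF t] by (rule integrable_mult_right)
    fix s
    show "\<bar>hitting_density t s * (heat s p x - heat t p x)\<bar> \<le> M * (hitting_density t s * (\<bar>s - t\<bar> / sqrt (s * t)))"
    proof (cases "0 < s")
      case True
      have "hitting_density t s * \<bar>heat s p x - heat t p x\<bar> \<le> hitting_density t s * (M * (\<bar>s - t\<bar> / sqrt (s * t)))"
        using abs_heat_diff_le[OF True t p] hitting_density_nonneg[OF t] by (intro mult_left_mono)
      then show ?thesis using hitting_density_nonneg[OF t, of s]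
        by (simp only: abs_mult abs_of_nonneg mult.left_commute)
    qed (simp add: hitting_density_eq_0)
  qed
  also have "\<dots> = M * (LINT s|lborel. hitting_density t s * (\<bar>s - t\<bar> / sqrt (s * t)))"
    by (rule integral_mult_right_zero)
  also have "\<dots> \<le> M * (4 / (sqrt pi * sqrt t))"
    using hitting_density_abs_deviation(2)[OF t] M by (rule mult_left_mono)
  finally show ?thesis .
qed

text \<open>Carries an error of quadratic growth through the Gaussian average, whose variance is
  \<open>2 * t\<close>. It serves approximations that are accurate only on a bounded
  interval.\<close>

lemma abs_heat_diff_quadratic:
  assumes t: "0 < t" and f: "f \<in> borel_measurable borel" "\<And>y. \<bar>f y\<bar> \<le> A"
    and p: "p \<in> borel_measurable borel" "\<And>y. \<bar>p y\<bar> \<le> B"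
    and le: "\<And>y. \<bar>f y - p y\<bar> \<le> \<epsilon> + K * y\<^sup>2" and K: "0 \<le> K"
  shows "\<bar>heat t f x - heat t p x\<bar> \<le> \<epsilon> + K * (2 * x\<^sup>2 + 4 * t)"
proof -
  define G where "G = normal_density x (sqrt (2 * t))"
  have G: "0 \<le> G y" for y by (simp add: G_def)
  have int: "integrable lborel (\<lambda>y. G y * f y)" "integrable lborel (\<lambda>y. G y * p y)"
    unfolding G_def using integrable_heat[OF t f] integrable_heat[OF t p] by auto
  have G0: "has_bochner_integral lborel G 1"
    using t by (simp add: G_def has_bochner_integral_iff)
  have G2: "has_bochner_integral lborel (\<lambda>y. G y * (y - x)\<^sup>2) (2 * t)"
    using normal_moment_even[of "sqrt (2 * t)" x 1] t by (simp add: G_def fact_numeral)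
  have "has_bochner_integral lborel (\<lambda>y. (\<epsilon> + K * (2 * x\<^sup>2)) * G y + (K * 2) * (G y * (y - x)\<^sup>2))
    ((\<epsilon> + K * (2 * x\<^sup>2)) * 1 + (K * 2) * (2 * t))"
    using G0 G2 by (intro has_bochner_integral_add has_bochner_integral_mult_right)
  then have hb: "has_bochner_integral lborel (\<lambda>y. G y * (\<epsilon> + K * (2 * x\<^sup>2 + 2 * (y - x)\<^sup>2))) (\<epsilon> + K * (2 * x\<^sup>2 + 4 * t))"
    by (simp add: algebra_simps)
  have "\<bar>heat t f x - heat t p x\<bar> = \<bar>LINT y|lborel. G y * (f y - p y)\<bar>"
    using int by (simp add: heat_def G_def right_diff_distrib)
  also have "\<dots> \<le> (LINT y|lborel. G y * (\<epsilon> + K * (2 * x\<^sup>2 + 2 * (y - x)\<^sup>2)))"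
  proof (rule integral_abs_bound_integral)
    show "integrable lborel (\<lambda>y. G y * (f y - p y))" using int by (simp add: right_diff_distrib)
    show "integrable lborel (\<lambda>y. G y * (\<epsilon> + K * (2 * x\<^sup>2 + 2 * (y - x)\<^sup>2)))"
      using hb by (simp only: has_bochner_integral_iff)
    fix y
    have "0 \<le> (y - 2 * x)\<^sup>2" by simp
    then have "y\<^sup>2 \<le> 2 * x\<^sup>2 + 2 * (y - x)\<^sup>2" by (simp add: power2_eq_square algebra_simps)
    then have "\<bar>f y - p y\<bar> \<le> \<epsilon> + K * (2 * x\<^sup>2 + 2 * (y - x)\<^sup>2)"
      using le[of y] K by (smt (verit) mult_left_mono)
    then show "\<bar>G y * (f y - p y)\<bar> \<le> G y * (\<epsilon> + K * (2 * x\<^sup>2 + 2 * (y - x)\<^sup>2))"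
      using G[of y] by (simp only: abs_mult abs_of_nonneg mult_left_mono)
  qed
  also have "\<dots> = \<epsilon> + K * (2 * x\<^sup>2 + 4 * t)" using hb by (simp only: has_bochner_integral_iff)
  finally show ?thesis .
qed

text \<open>For a trigonometric approximation of the data with accuracy \<open>\<delta>\<close>,
  three errors add up: comparison of the solutions, the estimate for the approximation, and the
  difference of the heat averages. Then \<open>\<delta>\<close> tends to 0 with \<open>x\<close> and
  \<open>t\<close> fixed.\<close>

lemma heat_approximation:
  fixes u :: "real \<times> real \<Rightarrow> real"
  assumes cont: "continuous_on {p. snd p \<le> 0} u"
    and L: "\<And>p. p \<in> Omega0 \<Longrightarrow> has_drift_laplacian u p 0"
    and bdd: "\<And>p. snd p \<le> 0 \<Longrightarrow> \<bar>u p\<bar> \<le> M"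
    and t: "0 < t"
  shows "\<bar>u (x, - t) - heat t (\<lambda>y. u (y, 0)) x\<bar> \<le> M * (4 / (sqrt pi * sqrt t))"
proof -
  define f where "f = (\<lambda>y. u (y, 0))"
  define c where "c = 4 / (sqrt pi * sqrt t)"
  \<comment> \<open>Collects the terms of the three errors that carry a factor
    \<open>\<delta>\<close>, once \<open>K = (2 * M + 1) * \<delta>\<close> is inserted.\<close>
  define C where "C = 2 + (2 * M + 1) * (3 * x\<^sup>2 + 7 * t) + c"
  have M: "0 \<le> M" using bdd[of "(0, 0)"] by simp
  have f: "continuous_on UNIV f" "\<And>y. \<bar>f y\<bar> \<le> M"
    unfolding f_def using bdd by (auto intro!: continuous_on_compose2[OF cont] continuous_intros)
  have main: "\<bar>u (x, - t) - heat t f x\<bar> \<le> M * c + \<delta> * C" if \<delta>: "0 < \<delta>" "\<delta> < 1" for \<delta>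
  proof -
    \<comment> \<open>For \<open>\<bar>y\<bar> > 1 / sqrt \<delta>\<close> one has
      \<open>\<delta> * y^2 \<ge> 1\<close>, so \<open>K * y^2\<close> exceeds \<open>2 * M\<close>
      and, with \<open>\<delta>\<close>, absorbs the trivial bound \<open>2 * M + \<delta>\<close>
      on the error. The summand 1 keeps \<open>K\<close> positive when \<open>M = 0\<close>, as
      comparison requires.\<close>
    define K where "K = (2 * M + 1) * \<delta>"
    have K: "0 < K" using \<delta> M by (simp add: K_def)
    obtain p where p: "trig_poly p" "\<And>y. \<bar>p y\<bar> \<le> M + \<delta>" "\<And>y. \<bar>y\<bar> \<le> 1 / sqrt \<delta> \<Longrightarrow> \<bar>f y - p y\<bar> \<le> \<delta>"
      using trig_poly_approx[OF f \<delta>(1), of "1 / sqrt \<delta>"] \<delta> by auto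
    have fp: "\<bar>f y - p y\<bar> \<le> \<delta> + K * y\<^sup>2" for y
    proof (cases "\<bar>y\<bar> \<le> 1 / sqrt \<delta>")
      case True
      have "0 \<le> K * y\<^sup>2" using K by simp
      then show ?thesis using p(3)[OF True] by linarith
    next
      case False
      then have "(1 / sqrt \<delta>)\<^sup>2 \<le> \<bar>y\<bar>\<^sup>2" using \<delta> by (intro power_mono) auto
      then have "1 \<le> \<delta> * y\<^sup>2" using \<delta> by (simp add: power_divide field_simps)
      then have "(2 * M + 1) * 1 \<le> (2 * M + 1) * (\<delta> * y\<^sup>2)" using M by (intro mult_left_mono) auto
      then show ?thesis using f(2)[of y] p(2)[of y] \<delta> unfolding K_def by (simp add: mult.assoc)
    qed
    obtain V where V: "subordinated p V" using trig_poly_subordinated[OF p(1)] by blast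
    then obtain B where B: "\<And>q. snd q \<le> 0 \<Longrightarrow> \<bar>V q\<bar> \<le> B" unfolding subordinated_def by blast
    have V': "continuous_on {p. snd p \<le> 0} V" "\<And>p. p \<in> Omega0 \<Longrightarrow> has_drift_laplacian V p 0"
        "\<And>x. V (x, 0) = p x"
      using V by (auto simp: subordinated_def)
    have pm: "p \<in> borel_measurable borel" "f \<in> borel_measurable borel"
      using trig_poly_continuous[OF p(1)] f(1) by (auto intro: borel_measurable_continuous_onI)
    have "u (x, - t) - V (x, - t) \<le> \<delta> + K * (x\<^sup>2 - 3 * - t)"
    proof (rule comparison_half_plane[OF cont V'(1) L V'(2), where A=M and B=B])
      show "u (x, 0) - V (x, 0) \<le> \<delta> + K * x\<^sup>2" for x using fp[of x] by (simp add: V' f_def)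
    qed (use bdd B K t in \<open>auto simp: abs_le_iff\<close>)
    moreover have "V (x, - t) - u (x, - t) \<le> \<delta> + K * (x\<^sup>2 - 3 * - t)"
    proof (rule comparison_half_plane[OF V'(1) cont V'(2) L, where A=B and B=M])
      show "V (x, 0) - u (x, 0) \<le> \<delta> + K * x\<^sup>2" for x using fp[of x] by (simp add: V' f_def)
    qed (use bdd B K t in \<open>auto simp: abs_le_iff\<close>)
    moreover have "\<bar>V (x, - t) - heat t p x\<bar> \<le> (M + \<delta>) * c"
      unfolding c_def by (rule subordinated_heat_estimate[OF V pm(1) p(2) t])
    moreover have "\<bar>heat t f x - heat t p x\<bar> \<le> \<delta> + K * (2 * x\<^sup>2 + 4 * t)"
      by (rule abs_heat_diff_quadratic[OF t pm(2) f(2) pm(1) p(2) fp]) (use K in simp)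
    moreover have "(M + \<delta>) * c + (\<delta> + K * (x\<^sup>2 - 3 * - t)) + (\<delta> + K * (2 * x\<^sup>2 + 4 * t)) = M * c + \<delta> * C"
      by (simp add: C_def K_def algebra_simps)
    ultimately show ?thesis by linarith
  qed
  have "((\<lambda>\<delta>. M * c + \<delta> * C) \<longlongrightarrow> M * c + 0 * C) (at_right 0)"
    by (intro tendsto_intros)
  moreover have "\<forall>\<^sub>F \<delta> in at_right 0. \<bar>u (x, - t) - heat t f x\<bar> \<le> M * c + \<delta> * C"
    unfolding eventually_at_right_field using main by (intro exI[of _ 1]) auto
  ultimately have "\<bar>u (x, - t) - heat t f x\<bar> \<le> M * c + 0 * C"
    by (rule tendsto_lowerbound) simp
  then show ?thesis by (simp add: f_def c_def)
qed

theorem proposition4p13: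
  "\<exists>c0::real. c0 = 5 \<and>
    (\<forall>u :: real \<times> real \<Rightarrow> real.
      Ck_closure 2 Omega0 u \<and> bounded (u ` Omega0) \<and>
      (\<forall>p\<in>Omega0. drift_laplacian u p = 0) \<longrightarrow>
      (\<forall>x2 x3. x3 \<le> -1 \<longrightarrow>
        \<bar>u (x2, x3) - 1 / sqrt (- 4 * pi * x3) *
            (LINT y|lborel. exp ((y - x2)\<^sup>2 / (4 * x3)) * u (y, 0))\<bar>
          \<le> c0 * sup_norm Omega0 u / sqrt (- x3)))"
proof (rule exI[of _ 5], intro conjI refl allI impI, elim conjE)
  fix u :: "real \<times> real \<Rightarrow> real" and x2 x3 :: real
  assume ck: "Ck_closure 2 Omega0 u" and bd: "bounded (u ` Omega0)"
    and L: "\<forall>p\<in>Omega0. drift_laplacian u p = 0" and x3: "x3 \<le> -1"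
  define M where "M = sup_norm Omega0 u"
  have cont: "continuous_on (closure Omega0) u" using ck by (simp add: Ck_closure_def)
  have "bdd_above ((\<lambda>p. \<bar>u p\<bar>) ` Omega0)"
    using bd by (auto simp: bounded_iff bdd_above_def)
  then have "\<forall>p\<in>Omega0. norm (u p) \<le> M"
    by (auto simp: M_def sup_norm_def intro: cSUP_upper)
  \<comment> \<open>The supremum runs over the open half plane; continuity up to the boundary
    extends the bound to the data on \<open>x3 = 0\<close>.\<close>
  then have M: "\<bar>u p\<bar> \<le> M" if "snd p \<le> 0" for p
    using continuous_on_closure_norm_le[OF cont, of M p] that by (simp add: closure_Omega0)
  have L': "has_drift_laplacian u p 0" if "p \<in> Omega0" for p
    using Ck_closure_has_drift_laplacian[OF ck that] L that by simp
  have "\<bar>u (x2, - (- x3)) - heat (- x3) (\<lambda>y. u (y, 0)) x2\<bar> \<le> M * (4 / (sqrt pi * sqrt (- x3)))"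
    by (rule heat_approximation) (use cont L' M x3 in \<open>auto simp: closure_Omega0\<close>)
  also have "\<dots> \<le> M * (5 / sqrt (- x3))"
  proof (rule mult_left_mono)
    \<comment> \<open>The constant \<open>4 / sqrt pi\<close> is about 2.26, so a crude lower bound
      for \<open>sqrt pi\<close> is enough.\<close>
    have "1 \<le> sqrt pi" using pi_gt3 by simp
    then have "4 / sqrt pi \<le> 5" by (subst pos_divide_le_eq) linarith+
    then have "4 / sqrt pi / sqrt (- x3) \<le> 5 / sqrt (- x3)"
      using x3 by (intro divide_right_mono) auto
    then show "4 / (sqrt pi * sqrt (- x3)) \<le> 5 / sqrt (- x3)" by simp
    show "0 \<le> M" using M[of "(0, 0)"] by simp
  qed
  also have "heat (- x3) (\<lambda>y. u (y, 0)) x2 = 1 / sqrt (- 4 * pi * x3) *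
            (LINT y|lborel. exp ((y - x2)\<^sup>2 / (4 * x3)) * u (y, 0))"
    unfolding heat_def using x3
    by (subst integral_mult_right_zero[symmetric], intro Bochner_Integration.integral_cong)
      (auto simp: normal_density_def)
  finally show "\<bar>u (x2, x3) - 1 / sqrt (- 4 * pi * x3) *
            (LINT y|lborel. exp ((y - x2)\<^sup>2 / (4 * x3)) * u (y, 0))\<bar>
          \<le> 5 * sup_norm Omega0 u / sqrt (- x3)"
    by (simp add: M_def mult.commute)
qed

end
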